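(* Let $(\mathscr{P}_1,\mathscr{V}_1)$ be a locally convex cone and let $(\mathscr{P}_2,\mathscr{V}_2)$ be a separated full uc-cone such that $\mathscr{P}_2$ is simultaneously a real vector space, and suppose $\mathscr{P}_2$ is complete with respect to its symmetric topology. Let $v$ be the generating element of $\mathscr{V}_2$. Let $\varepsilon>0$ and let $f,g,h:\mathscr{P}_1\to\mathscr{P}_2$ be mappings such that $$f(x+y)\in(\varepsilon v)\big(g(x)+h(y)\big)(\varepsilon v)\qquad\text{for all }x,y\in\mathscr{P}_1.$$ Then there exists a unique additive mapping $A:\mathscr{P}_1\to\mathscr{P}_2$ for which there are positive constants $\beta,\gamma,\delta$ such that, for all $x\in\mathscr{P}_1$ and all real $r>1$, $$A(x)\in\big((4r\varepsilon+\beta)v\big)\big(f(x)\big)\big((4r\varepsilon+\beta)v\big),$$ $$A(x)\in\big((5r\varepsilon+\gamma)v\big)\big(g(x)\big)\big((5r\varepsilon+\gamma)v\big),$$ $$A(x)\in\big((5r\varepsilon+\delta)v\big)\big(h(x)\big)\big((5r\varepsilon+\delta)v\big).$$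
   Context: A cone is a set $\mathscr{P}$ with an associative, commutative addition having a neutral element $0$, and a multiplication by real scalars $\lambda\ge 0$ satisfying $\lambda(\mu a)=(\lambda\mu)a$, $(\lambda+\mu)a=\lambda a+\mu a$, $\lambda(a+b)=\lambda a+\lambda b$, $1a=a$, $0a=0$. No cancellation law is assumed. A preordered cone is a cone with a reflexive transitive relation $\leqslant$ (not necessarily antisymmetric) such that $a\leqslant b$ implies $a+c\leqslant b+c$ and $\lambda a\leqslant\lambda b$ for all $c\in\mathscr{P}$, $\lambda\ge0$. An abstract $0$-neighborhood system in a preordered cone $\mathscr{P}$ is a subset $\mathscr{V}\subseteq\mathscr{P}$ such that: (i) $0<v$ (i.e. $0\leqslant v$ and $v\neq0$) for all $v\in\mathscr{V}$; (ii) for all $u,v\in\mathscr{V}$ there is $w\in\mathscr{V}$ with $w\leqslant u$ and $w\leqslant v$; (iii) $u+v\in\mathscr{V}$ and $\lambda v\in\mathscr{V}$ for all $u,v\in\mathscr{V}$, $\lambda>0$. A full locally convex cone is a pair $(\mathscr{P},\mathscr{V})$ of a preordered cone and an abstract $0$-neighborhood system $\mathscr{V}\subseteq\mathscr{P}$ such that every element is bounded below: for all $a\in\mathscr{P}$, $v\in\mathscr{V}$ there is $\rho>0$ with $0\leqslant a+\rho v$. A locally convex cone $(\mathscr{P},\mathscr{V})$ is a subcone $\mathscr{P}$ of a full locally convex cone with neighborhood system $\mathscr{V}$ ($\mathscr{P}$ need not contain $\mathscr{V}$; inequalities involving elements of $\mathscr{V}$ are taken in the full cone). A uc-cone is a locally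 convex cone with $\mathscr{V}=\{\lambda w:\lambda>0\}$ for some $w\in\mathscr{V}$, called the generating element of $\mathscr{V}$. That $\mathscr{P}_2$ is simultaneously a real vector space means that its cone operations are the restrictions of real vector space operations on $\mathscr{P}_2$. For $v\in\mathscr{V}$, $a\in\mathscr{P}$: $v(a)=\{b\in\mathscr{P}: b\leqslant a+v\}$, $(a)v=\{b\in\mathscr{P}: a\leqslant b+v\}$, and $v(a)v=v(a)\cap(a)v$ is the symmetric neighborhood of $a$; these generate the upper, lower and symmetric topologies. The closure of $a$ is $\overline{a}=\bigcap_{v\in\mathscr{V}}v(a)$; $(\mathscr{P},\mathscr{V})$ is separated if $\overline a=\overline b$ implies $a=b$. A net $(a_i)$ converges to $a$ in the symmetric topology if for every $v\in\mathscr{V}$ there is $i_0$ with $a_i\leqslant a+v$ and $a\leqslant a_i+v$ for all $i\ge i_0$; it is Cauchy if for every $v\in\mathscr{V}$ there is $i_0$ with $a_i\leqslant a_j+v$ for all $i,j\ge i_0$. The cone is complete (with respect to the symmetric topology) if every Cauchy net converges to an element of $\mathscr{P}$ in the symmetric topology. A mapping $A$ is additive if $A(x+y)=A(x)+A(y)$ for all $x,y$. *)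

theory Defs
  imports Complex_Main "HOL-Library.FuncSet"
begin

text \<open>
  The values of scaleR at negative scalars are left unconstrained and carry no meaning
  in a general cone. A type of sort real_vector is a cone under its own addition and
  scaling, so a preordered cone that is simultaneously a real vector space is a type
  belonging to both preordered_cone and real_vector.
\<close>

class abstract_cone = comm_monoid_add + scaleR +
  assumes cone_scaleR_scaleR: "0 \<le> a \<Longrightarrow> 0 \<le> b \<Longrightarrow> a *\<^sub>R (b *\<^sub>R x) = (a * b) *\<^sub>R x"
    and cone_scaleR_add_left: "0 \<le> a \<Longrightarrow> 0 \<le> b \<Longrightarrow> (a + b) *\<^sub>R x = a *\<^sub>R x + b *\<^sub>R x"
    and cone_scaleR_add_right: "0 \<le> a \<Longrightarrow> a *\<^sub>R (x + y) = a *\<^sub>R x + a *\<^sub>R y"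
    and cone_scaleR_one: "1 *\<^sub>R x = x"
    and cone_scaleR_zero: "0 *\<^sub>R x = 0"

instance real_vector \<subseteq> abstract_cone
  by standard (simp_all add: scaleR_add_left scaleR_add_right)

class preordered_cone = abstract_cone + preorder +
  assumes cone_add_right_mono: "x \<le> y \<Longrightarrow> x + z \<le> y + z"
    and cone_scaleR_left_mono: "x \<le> y \<Longrightarrow> 0 \<le> a \<Longrightarrow> a *\<^sub>R x \<le> a *\<^sub>R y"

text \<open>
  In the first condition, positivity of a neighborhood means \<open>0 \<le> v\<close> and \<open>v \<noteq> 0\<close>;
  this is not the strict order of class preorder, for which \<open>0 < v\<close> would mean
  \<open>0 \<le> v\<close> and not \<open>v \<le> 0\<close>.
\<close>

definition abstract_nbhd_system :: "'a::preordered_cone set \<Rightarrow> bool" where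
  "abstract_nbhd_system V \<longleftrightarrow>
     (\<forall>v\<in>V. 0 \<le> v \<and> v \<noteq> 0) \<and>
     (\<forall>u\<in>V. \<forall>v\<in>V. \<exists>w\<in>V. w \<le> u \<and> w \<le> v) \<and>
     (\<forall>u\<in>V. \<forall>v\<in>V. u + v \<in> V) \<and>
     (\<forall>v\<in>V. \<forall>l::real. 0 < l \<longrightarrow> l *\<^sub>R v \<in> V)"

text \<open>The full cone is the whole type; a locally convex cone is a subcone of it.\<close>

definition full_locally_convex_cone :: "'a::preordered_cone set \<Rightarrow> bool" where
  "full_locally_convex_cone V \<longleftrightarrow>
     abstract_nbhd_system V \<and> (\<forall>a. \<forall>v\<in>V. \<exists>\<rho>::real. 0 < \<rho> \<and> 0 \<le> a + \<rho> *\<^sub>R v)"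

definition subcone :: "'a::abstract_cone set \<Rightarrow> bool" where
  "subcone P \<longleftrightarrow>
     0 \<in> P \<and> (\<forall>x\<in>P. \<forall>y\<in>P. x + y \<in> P) \<and> (\<forall>x\<in>P. \<forall>l::real. 0 \<le> l \<longrightarrow> l *\<^sub>R x \<in> P)"

definition locally_convex_cone :: "'a::preordered_cone set \<Rightarrow> 'a set \<Rightarrow> bool" where
  "locally_convex_cone P V \<longleftrightarrow> full_locally_convex_cone V \<and> subcone P"

definition generating_element :: "'a::preordered_cone \<Rightarrow> 'a set \<Rightarrow> bool" where
  "generating_element w V \<longleftrightarrow> w \<in> V \<and> V = {l *\<^sub>R w | l::real. 0 < l}"

definition uc_cone :: "'a::preordered_cone set \<Rightarrow> 'a set \<Rightarrow> bool" where
  "uc_cone P V \<longleftrightarrow> locally_convex_cone P V \<and> (\<exists>w. generating_element w V)"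

definition upper_nbhd :: "'a::preordered_cone set \<Rightarrow> 'a \<Rightarrow> 'a \<Rightarrow> 'a set" where
  "upper_nbhd P v a = {b \<in> P. b \<le> a + v}"

definition lower_nbhd :: "'a::preordered_cone set \<Rightarrow> 'a \<Rightarrow> 'a \<Rightarrow> 'a set" where
  "lower_nbhd P v a = {b \<in> P. a \<le> b + v}"

definition symmetric_nbhd :: "'a::preordered_cone set \<Rightarrow> 'a \<Rightarrow> 'a \<Rightarrow> 'a set" where
  "symmetric_nbhd P v a = upper_nbhd P v a \<inter> lower_nbhd P v a"

definition element_closure :: "'a::preordered_cone set \<Rightarrow> 'a set \<Rightarrow> 'a \<Rightarrow> 'a set" where
  "element_closure P V a = (\<Inter>v\<in>V. upper_nbhd P v a)"

definition separated_cone :: "'a::preordered_cone set \<Rightarrow> 'a set \<Rightarrow> bool" where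
  "separated_cone P V \<longleftrightarrow>
     (\<forall>a\<in>P. \<forall>b\<in>P. element_closure P V a = element_closure P V b \<longrightarrow> a = b)"

definition directed_set :: "'i set \<Rightarrow> ('i \<Rightarrow> 'i \<Rightarrow> bool) \<Rightarrow> bool" where
  "directed_set I le \<longleftrightarrow>
     I \<noteq> {} \<and> (\<forall>i\<in>I. le i i) \<and>
     (\<forall>i\<in>I. \<forall>j\<in>I. \<forall>k\<in>I. le i j \<longrightarrow> le j k \<longrightarrow> le i k) \<and>
     (\<forall>i\<in>I. \<forall>j\<in>I. \<exists>k\<in>I. le i k \<and> le j k)"

definition symmetric_net_converges ::
    "'a::preordered_cone set \<Rightarrow> 'i set \<Rightarrow> ('i \<Rightarrow> 'i \<Rightarrow> bool) \<Rightarrow> ('i \<Rightarrow> 'a) \<Rightarrow> 'a \<Rightarrow> bool" where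
  "symmetric_net_converges V I le s a \<longleftrightarrow>
     (\<forall>v\<in>V. \<exists>i0\<in>I. \<forall>i\<in>I. le i0 i \<longrightarrow> s i \<le> a + v \<and> a \<le> s i + v)"

definition symmetric_net_Cauchy ::
    "'a::preordered_cone set \<Rightarrow> 'i set \<Rightarrow> ('i \<Rightarrow> 'i \<Rightarrow> bool) \<Rightarrow> ('i \<Rightarrow> 'a) \<Rightarrow> bool" where
  "symmetric_net_Cauchy V I le s \<longleftrightarrow>
     (\<forall>v\<in>V. \<exists>i0\<in>I. \<forall>i\<in>I. \<forall>j\<in>I. le i0 i \<longrightarrow> le i0 j \<longrightarrow> s i \<le> s j + v)"

text \<open>
  A definition cannot quantify over the type of indices of a net. The index type
  \<open>'a \<times> 'a set\<close> is large enough: the lemma following the definition gives convergence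
  of Cauchy nets indexed by an arbitrary type.
\<close>

definition symmetric_complete :: "'a::preordered_cone set \<Rightarrow> 'a set \<Rightarrow> bool" where
  "symmetric_complete P V \<longleftrightarrow>
     (\<forall>(I :: ('a \<times> 'a set) set) le s.
        directed_set I le \<longrightarrow> s ` I \<subseteq> P \<longrightarrow> symmetric_net_Cauchy V I le s \<longrightarrow>
        (\<exists>a\<in>P. symmetric_net_converges V I le s a))"

lemma symmetric_complete_net:
  fixes I :: "'i set" and s :: "'i \<Rightarrow> 'a::preordered_cone"
  assumes compl: "symmetric_complete P V" and dir: "directed_set I le"
    and sP: "s ` I \<subseteq> P" and Cau: "symmetric_net_Cauchy V I le s"
  shows "\<exists>a\<in>P. symmetric_net_converges V I le s a"
proof -
  define T where "T i = s ` {j \<in> I. le i j}" for i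
  define J where "J = {(x, T i) | x i. i \<in> I \<and> x \<in> T i}"
  define ge where "ge p q \<longleftrightarrow> snd q \<subseteq> snd p" for p q :: "'a \<times> 'a set"
  have refl: "le i i" if "i \<in> I" for i using dir that by (simp add: directed_set_def)
  have trans: "le i k" if "i \<in> I" "j \<in> I" "k \<in> I" "le i j" "le j k" for i j k
    using dir that unfolding directed_set_def by blast
  have T_mono: "T j \<subseteq> T i" if "i \<in> I" "j \<in> I" "le i j" for i j
    using that trans unfolding T_def by blast
  have mem: "(s i, T i) \<in> J" if "i \<in> I" for i
    using that refl unfolding J_def T_def by blast
  have dirJ: "directed_set J ge"
  proof -
    have "J \<noteq> {}" using dir mem by (auto simp: directed_set_def)
    moreover have "\<exists>r\<in>J. ge p r \<and> ge q r" if pq: "p \<in> J" "q \<in> J" for p q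
    proof -
      obtain i j where ij: "i \<in> I" "j \<in> I" "snd p = T i" "snd q = T j"
        using pq unfolding J_def by fastforce
      then obtain k where "k \<in> I" "le i k" "le j k"
        using dir unfolding directed_set_def by blast
      then show ?thesis
        using ij T_mono mem by (intro bexI[of _ "(s k, T k)"]) (auto simp: ge_def)
    qed
    ultimately show ?thesis
      unfolding directed_set_def by (auto simp: ge_def)
  qed
  have fst_in: "fst p \<in> T i" if "p \<in> J" "ge (s i, T i) p" for p i
    using that unfolding J_def ge_def by auto
  have "symmetric_net_Cauchy V J ge fst"
    unfolding symmetric_net_Cauchy_def
  proof
    fix v assume "v \<in> V"
    then obtain i0 where i0: "i0 \<in> I"
      "\<And>i j. i \<in> I \<Longrightarrow> j \<in> I \<Longrightarrow> le i0 i \<Longrightarrow> le i0 j \<Longrightarrow> s i \<le> s j + v"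
      using Cau unfolding symmetric_net_Cauchy_def by blast
    have "fst p \<le> fst q + v" if "p \<in> J" "q \<in> J" "ge (s i0, T i0) p" "ge (s i0, T i0) q" for p q
      using fst_in[OF that(1,3)] fst_in[OF that(2,4)] i0(2) unfolding T_def by auto
    then show "\<exists>r\<in>J. \<forall>p\<in>J. \<forall>q\<in>J. ge r p \<longrightarrow> ge r q \<longrightarrow> fst p \<le> fst q + v"
      using mem[OF i0(1)] by blast
  qed
  moreover have "fst ` J \<subseteq> P" using sP unfolding J_def T_def by auto
  ultimately obtain a where a: "a \<in> P" "symmetric_net_converges V J ge fst a"
    using compl dirJ unfolding symmetric_complete_def by blast
  have "symmetric_net_converges V I le s a"
    unfolding symmetric_net_converges_def
  proof
    fix v assume "v \<in> V"
    then obtain p where p: "p \<in> J"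
      "\<And>q. q \<in> J \<Longrightarrow> ge p q \<Longrightarrow> fst q \<le> a + v \<and> a \<le> fst q + v"
      using a(2) unfolding symmetric_net_converges_def by blast
    obtain i where i: "i \<in> I" "snd p = T i" using p(1) unfolding J_def by force
    have "s k \<le> a + v \<and> a \<le> s k + v" if "k \<in> I" "le i k" for k
      using p(2)[OF mem[OF that(1)]] T_mono[OF i(1) that] i(2) by (simp add: ge_def)
    then show "\<exists>i0\<in>I. \<forall>k\<in>I. le i0 k \<longrightarrow> s k \<le> a + v \<and> a \<le> s k + v"
      using i(1) by blast
  qed
  with a(1) show ?thesis by blast
qed

definition additive_on :: "'a::plus set \<Rightarrow> ('a \<Rightarrow> 'b::plus) \<Rightarrow> bool" where
  "additive_on P A \<longleftrightarrow> (\<forall>x\<in>P. \<forall>y\<in>P. A (x + y) = A x + A y)"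

end

theory Submission
  imports Defs
begin

text \<open>
  In a real vector space with order unit \<open>v\<close>, symmetric closeness up to \<open>c v\<close> behaves like
  distance at most \<open>c\<close> for the order-unit norm. Setting one argument to \<open>0\<close> expresses \<open>g\<close> and
  \<open>h\<close> through \<open>f\<close> up to \<open>\<epsilon>\<close>, so \<open>f - g 0 - h 0\<close> is additive up to \<open>3 \<epsilon>\<close>, and Hyers' limit of
  \<open>2\<^sup>-\<^sup>n \<phi> (2\<^sup>n x)\<close> produces the additive map. Two additive maps at bounded distance agree,
  by comparing them at \<open>n x\<close>.
\<close>

section \<open>Calculus of closeness for the order unit\<close>

definition near :: "'b::{real_vector, preordered_cone} \<Rightarrow> real \<Rightarrow> 'b \<Rightarrow> 'b \<Rightarrow> bool" where
  "near v c a b \<longleftrightarrow> a \<le> b + c *\<^sub>R v \<and> b \<le> a + c *\<^sub>R v"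

lemma symmetric_nbhd_iff_near: "a \<in> symmetric_nbhd UNIV (c *\<^sub>R v) b \<longleftrightarrow> near v c a b"
  by (simp add: symmetric_nbhd_def upper_nbhd_def lower_nbhd_def near_def)

lemma near_sym: "near v c a b \<Longrightarrow> near v c b a"
  by (simp add: near_def)

lemma le_add_trans:
  fixes a b d v :: "'b::{real_vector, preordered_cone}"
  assumes "a \<le> b + c *\<^sub>R v" "b \<le> d + e *\<^sub>R v"
  shows "a \<le> d + (c + e) *\<^sub>R v"
  using order_trans[OF assms(1) cone_add_right_mono[OF assms(2)]]
  by (simp add: algebra_simps)

lemma near_trans: "near v c a b \<Longrightarrow> near v d b e \<Longrightarrow> near v (c + d) a e"
  unfolding near_def by (metis le_add_trans add.commute)

lemma near_translate: "near v c a b \<Longrightarrow> near v c (a + z) (b + z)"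
  unfolding near_def
  by (metis cone_add_right_mono add.assoc add.commute)

lemma near_add:
  assumes "near v c a b" "near v d a' b'"
  shows "near v (c + d) (a + a') (b + b')"
proof -
  have "near v d (b + a') (b + b')"
    using near_translate[OF assms(2), of b] by (simp add: add.commute)
  then show ?thesis using near_trans near_translate[OF assms(1)] by blast
qed

lemma near_scaleR: "near v c a b \<Longrightarrow> 0 \<le> l \<Longrightarrow> near v (l * c) (l *\<^sub>R a) (l *\<^sub>R b)"
  unfolding near_def
  by (metis cone_scaleR_left_mono scaleR_add_right scaleR_scaleR)

lemma near_mono:
  assumes "0 \<le> v" "c \<le> d" "near v c a b"
  shows "near v d a b"
proof -
  have "0 \<le> (d - c) *\<^sub>R v"
    using cone_scaleR_left_mono[OF assms(1), of "d - c"] assms(2) by simp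
  from cone_add_right_mono[OF this, of "x + c *\<^sub>R v" for x]
  have "x + c *\<^sub>R v \<le> x + d *\<^sub>R v" for x by (simp add: algebra_simps)
  then show ?thesis using assms(3) unfolding near_def by (meson order_trans)
qed

section \<open>Boundedness, separation and completeness in terms of closeness\<close>

text \<open>Subtraction lets boundedness below be applied to both \<open>b - a\<close> and
  \<open>a - b\<close>, which bounds the distance from both sides.\<close>

lemma near_bounded:
  assumes "0 \<le> v" and bd: "\<And>a. \<exists>\<rho>::real. 0 < \<rho> \<and> 0 \<le> a + \<rho> *\<^sub>R v"
  shows "\<exists>c>0. near v c a b"
proof -
  obtain p where p: "0 < p" "0 \<le> (b - a) + p *\<^sub>R v" using bd by blast
  obtain q where q: "0 < q" "0 \<le> (a - b) + q *\<^sub>R v" using bd by blast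
  have "a \<le> b + p *\<^sub>R v"
    using cone_add_right_mono[OF p(2), of a] by (simp add: algebra_simps)
  moreover have "b \<le> a + q *\<^sub>R v"
    using cone_add_right_mono[OF q(2), of b] by (simp add: algebra_simps)
  \<comment> \<open>Positivity of \<open>v\<close> allows both one-sided radii to be enlarged to
    \<open>p + q\<close>.\<close>
  moreover have "x \<le> x + s *\<^sub>R v" if "0 < s" for x s
    using cone_add_right_mono[OF cone_scaleR_left_mono[OF assms(1), of s], of x] that
    by (simp add: algebra_simps)
  ultimately have "a \<le> b + (p + q) *\<^sub>R v" "b \<le> a + (p + q) *\<^sub>R v"
    using p(1) q(1) by (metis add.assoc order_trans scaleR_add_left add.commute)+
  then show ?thesis using p(1) q(1) unfolding near_def by (meson add_pos_pos)
qed

text \<open>The two closures coincide: half of a given radius is spent on getting from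
  \<open>x\<close> to \<open>a\<close>, the other half on getting from \<open>a\<close> to
  \<open>b\<close>. Symmetry of closeness gives the reverse inclusion.\<close>

lemma separated_near_eq:
  assumes sep: "separated_cone UNIV V" and gen: "generating_element v V"
    and near: "\<And>c. 0 < c \<Longrightarrow> near v c a b"
  shows "a = b"
proof -
  have V: "V = {l *\<^sub>R v | l. 0 < l}" using gen unfolding generating_element_def by simp
  have sub: "element_closure UNIV V a \<subseteq> element_closure UNIV V b"
    if near: "\<And>c. 0 < c \<Longrightarrow> near v c a b" for a b
  proof
    fix x assume x: "x \<in> element_closure UNIV V a"
    have "x \<le> b + l *\<^sub>R v" if "0 < l" for l
    proof -
      have "(l / 2) *\<^sub>R v \<in> V"
        unfolding V using that by (auto intro: exI[of _ "l / 2"])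
      then have "x \<le> a + (l / 2) *\<^sub>R v"
        using x unfolding element_closure_def upper_nbhd_def by auto
      moreover have "a \<le> b + (l / 2) *\<^sub>R v"
        using near[of "l / 2"] that unfolding near_def by auto
      ultimately show ?thesis using le_add_trans by (metis field_sum_of_halves)
    qed
    then show "x \<in> element_closure UNIV V b"
      unfolding element_closure_def upper_nbhd_def V by auto
  qed
  have "element_closure UNIV V a = element_closure UNIV V b"
    using sub[of a b] sub[of b a] near near_sym by blast
  then show ?thesis using sep unfolding separated_cone_def by blast
qed

text \<open>As the neighborhoods are exactly the positive multiples of \<open>v\<close>, net
  convergence along the naturals becomes an epsilon-N statement in the radius.\<close>

lemma symmetric_complete_sequence:
  assumes compl: "symmetric_complete UNIV V" and gen: "generating_element v V"
    and Cauchy: "\<And>c. 0 < c \<Longrightarrow> \<exists>N. \<forall>m\<ge>N. \<forall>n\<ge>N. near v c (s m) (s n)"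
  shows "\<exists>a. \<forall>c>0. \<exists>N::nat. \<forall>n\<ge>N. near v c (s n) a"
proof -
  have V: "V = {l *\<^sub>R v | l. 0 < l}" using gen unfolding generating_element_def by simp
  have "directed_set (UNIV::nat set) (\<le>)"
    unfolding directed_set_def by (auto intro: max.cobounded1 max.cobounded2)
  moreover have "symmetric_net_Cauchy V UNIV (\<le>) s"
    unfolding symmetric_net_Cauchy_def V using Cauchy unfolding near_def by auto blast
  ultimately obtain a where "symmetric_net_converges V UNIV (\<le>) s a"
    using symmetric_complete_net[OF compl] by blast
  then show ?thesis
    unfolding symmetric_net_converges_def V near_def by (auto intro!: exI[of _ a])
qed

section \<open>Hyers' direct method on a cone\<close>

text \<open>Doubling needs only nonnegative scalars, so the domain may be a cone. The bound is
  stated for every \<open>c > k\<close> because order inequalities need not survive limits: the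
  limit is reached only up to the slack \<open>c - k\<close>.\<close>

lemma hyers_stability:
  fixes \<phi> :: "'a::abstract_cone \<Rightarrow> 'b::{real_vector, preordered_cone}"
  assumes P: "subcone P" and v: "0 \<le> v" and k: "0 \<le> k"
    and sep: "separated_cone UNIV V" and compl: "symmetric_complete UNIV V"
    and gen: "generating_element v V"
    and \<phi>: "\<And>x y. x \<in> P \<Longrightarrow> y \<in> P \<Longrightarrow> near v k (\<phi> (x + y)) (\<phi> x + \<phi> y)"
  shows "\<exists>A. additive_on P A \<and> (\<forall>x\<in>P. \<forall>c>k. near v c (A x) (\<phi> x))"
proof -
  define s where "s x n = (1 / 2 ^ n) *\<^sub>R \<phi> ((2 ^ n) *\<^sub>R x)" for x n
  have memP: "(2 ^ n) *\<^sub>R x \<in> P" if "x \<in> P" for x n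
    using P that unfolding subcone_def by simp
  have step: "near v (k / 2 ^ Suc n) (s x (Suc n)) (s x n)" if "x \<in> P" for x n
  proof -
    let ?y = "(2 ^ n) *\<^sub>R x"
    have "(2 ^ Suc n) *\<^sub>R x = ?y + ?y"
      using cone_scaleR_add_left[of "2 ^ n" "2 ^ n" x] by simp
    then have "near v k (\<phi> ((2 ^ Suc n) *\<^sub>R x)) (2 *\<^sub>R \<phi> ?y)"
      using \<phi>[OF memP memP, OF that that, of n n] by (simp add: scaleR_2)
    from near_scaleR[OF this, of "1 / 2 ^ Suc n"] show ?thesis
      by (simp add: s_def)
  qed
  \<comment> \<open>The radius is the exact geometric sum of the step errors, a form that the
    induction reproduces.\<close>
  have cumul: "near v (k * (1 / 2 ^ n - 1 / 2 ^ (n + m))) (s x (n + m)) (s x n)"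
    if "x \<in> P" for x n m
  proof (induction m)
    case 0
    then show ?case by (simp add: near_def)
  next
    case (Suc m)
    from near_trans[OF step[OF that, of "n + m"] Suc] show ?case
      by (simp add: field_simps)
  qed
  have dist: "near v (k / 2 ^ n) (s x m) (s x n)" if "x \<in> P" "n \<le> m" for x n m
  proof (rule near_mono[OF v])
    show "near v (k * (1 / 2 ^ n - 1 / 2 ^ m)) (s x m) (s x n)"
      using cumul[OF that(1), of n "m - n"] that(2) by simp
    show "k * (1 / 2 ^ n - 1 / 2 ^ m) \<le> k / 2 ^ n"
      using k by (simp add: right_diff_distrib)
  qed
  have small: "\<exists>N. \<forall>n\<ge>N. k / 2 ^ n < c" if "0 < c" for c
  proof -
    have "(\<lambda>n. k * (1 / 2) ^ n) \<longlonglongrightarrow> k * 0"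
      by (intro tendsto_mult tendsto_const LIMSEQ_realpow_zero) auto
    then have "\<forall>\<^sub>F n in sequentially. k * (1 / 2) ^ n < c"
      using that by (intro order_tendstoD) auto
    then show ?thesis by (simp add: eventually_sequentially power_one_over)
  qed
  have "\<exists>a. \<forall>c>0. \<exists>N. \<forall>n\<ge>N. near v c (s x n) a" if x: "x \<in> P" for x
  proof (rule symmetric_complete_sequence[OF compl gen])
    fix c :: real assume "0 < c"
    then obtain N where N: "k / 2 ^ N < c / 2" using small[of "c / 2"] by auto
    have "near v c (s x m) (s x n)" if "m \<ge> N" "n \<ge> N" for m n
    proof (rule near_mono[OF v])
      show "near v (k / 2 ^ N + k / 2 ^ N) (s x m) (s x n)"
        by (rule near_trans[OF dist[OF x that(1)] near_sym[OF dist[OF x that(2)]]])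
      show "k / 2 ^ N + k / 2 ^ N \<le> c" using N by linarith
    qed
    then show "\<exists>N. \<forall>m\<ge>N. \<forall>n\<ge>N. near v c (s x m) (s x n)" by blast
  qed
  then obtain A where A: "\<And>x c. x \<in> P \<Longrightarrow> 0 < c \<Longrightarrow> \<exists>N. \<forall>n\<ge>N. near v c (s x n) (A x)"
    by metis
  have "A (x + y) = A x + A y" if x: "x \<in> P" and y: "y \<in> P" for x y
  proof (rule separated_near_eq[OF sep gen])
    fix c :: real assume c: "0 < c"
    have xy: "x + y \<in> P" using P x y unfolding subcone_def by blast
    have c4: "0 < c / 4" using c by simp
    \<comment> \<open>The quarters pay for four errors: the three limits and the additivity defect
      \<open>k / 2 ^ n\<close> of the approximants.\<close>
    obtain N1 N2 N3 N4 where N: "\<forall>n\<ge>N1. near v (c / 4) (s x n) (A x)"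
        "\<forall>n\<ge>N2. near v (c / 4) (s y n) (A y)"
        "\<forall>n\<ge>N3. near v (c / 4) (s (x + y) n) (A (x + y))"
        "\<forall>n\<ge>N4. k / 2 ^ n < c / 4"
      using A[OF x c4] A[OF y c4] A[OF xy c4] small[OF c4] by blast
    define n where "n = Max {N1, N2, N3, N4}"
    have n: "near v (c / 4) (s x n) (A x)" "near v (c / 4) (s y n) (A y)"
        "near v (c / 4) (s (x + y) n) (A (x + y))" "k / 2 ^ n \<le> c / 4"
      using N by (auto simp: n_def less_imp_le)
    have "near v (k / 2 ^ n) (s (x + y) n) (s x n + s y n)"
      using near_scaleR[OF \<phi>[OF memP memP, OF x y, of n n], of "1 / 2 ^ n"]
      by (simp add: s_def cone_scaleR_add_right scaleR_add_right)
    then have "near v (c / 4) (s (x + y) n) (s x n + s y n)"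
      using near_mono[OF v n(4)] by blast
    then have "near v (c / 4 + c / 4 + (c / 4 + c / 4)) (A (x + y)) (A x + A y)"
      using near_trans[OF near_trans[OF near_sym[OF n(3)]] near_add[OF n(1,2)]] by blast
    then show "near v c (A (x + y)) (A x + A y)" by simp
  qed
  then have "additive_on P A" unfolding additive_on_def by blast
  moreover have "near v c (A x) (\<phi> x)" if x: "x \<in> P" and c: "k < c" for x c
  proof -
    obtain N where "near v (c - k) (s x N) (A x)" using A[OF x, of "c - k"] c by auto
    \<comment> \<open>The approximant at index 0 is \<open>\<phi> x\<close> itself.\<close>
    moreover have "near v k (s x N) (\<phi> x)"
      using dist[OF x, of 0 N] by (simp add: s_def cone_scaleR_one)
    ultimately show ?thesis using near_trans[OF near_sym] by fastforce
  qed
  ultimately show ?thesis by blast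
qed

section \<open>Rigidity of additive maps at bounded distance\<close>

lemma additive_on_scaleR_nat:
  fixes A :: "'a::abstract_cone \<Rightarrow> 'b::real_vector"
  assumes P: "subcone P" and A: "additive_on P A" and x: "x \<in> P"
  shows "A (real n *\<^sub>R x) = real n *\<^sub>R A x"
proof (induction n)
  case 0
  \<comment> \<open>Cancellation in the vector space codomain turns this into
    \<open>A 0 = 0\<close>.\<close>
  have "A (0 + 0) = A 0 + A 0" using P A unfolding subcone_def additive_on_def by blast
  then show ?case by (simp add: cone_scaleR_zero)
next
  case (Suc n)
  have "real (Suc n) *\<^sub>R x = real n *\<^sub>R x + x"
    using cone_scaleR_add_left[of "real n" 1 x] by (simp add: cone_scaleR_one add.commute)
  moreover have "real n *\<^sub>R x \<in> P" using P x unfolding subcone_def by simp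
  ultimately have "A (real (Suc n) *\<^sub>R x) = A (real n *\<^sub>R x) + A x"
    using A x unfolding additive_on_def by metis
  then show ?case by (simp add: Suc algebra_simps)
qed

text \<open>Closeness within \<open>c\<close> at \<open>n x\<close> becomes closeness within
  \<open>c / n\<close> at \<open>x\<close>, hence within every positive radius.\<close>

lemma additive_on_unique:
  fixes A B :: "'a::abstract_cone \<Rightarrow> 'b::{real_vector, preordered_cone}"
  assumes P: "subcone P" and v: "0 \<le> v"
    and sep: "separated_cone UNIV V" and gen: "generating_element v V"
    and A: "additive_on P A" and B: "additive_on P B"
    and near: "\<And>x. x \<in> P \<Longrightarrow> near v c (A x) (B x)" and x: "x \<in> P"
  shows "A x = B x"
proof (rule separated_near_eq[OF sep gen])
  fix d :: real assume d: "0 < d"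
  \<comment> \<open>No sign of \<open>c\<close> is assumed; the absolute value forces
    \<open>n\<close> to be positive.\<close>
  obtain n :: nat where n: "\<bar>c\<bar> / d < real n" using reals_Archimedean2 by blast
  have n0: "0 < real n" using n d by (smt (verit) divide_nonneg_pos)
  have "real n *\<^sub>R x \<in> P" using P x unfolding subcone_def by simp
  from near_scaleR[OF near[OF this], of "1 / real n"]
  have "near v (c / real n) (A x) (B x)"
    using n0 by (simp add: additive_on_scaleR_nat[OF P A x] additive_on_scaleR_nat[OF P B x])
  moreover have "c / real n \<le> d"
    using n n0 d by (simp add: field_simps)
  ultimately show "near v d (A x) (B x)" using near_mono[OF v] by blast
qed

section \<open>Reduction of three functions to one approximately additive map\<close>

theorem theorem2p11:
  fixes P1 V1 :: "'a::preordered_cone set"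
    and V2 :: "'b::{real_vector, preordered_cone} set"
    and v :: 'b and \<epsilon> :: real
    and f g h :: "'a \<Rightarrow> 'b"
  assumes "locally_convex_cone P1 V1"
    and "full_locally_convex_cone V2"
    and "uc_cone UNIV V2"
    and "separated_cone UNIV V2"
    and "symmetric_complete UNIV V2"
    and "generating_element v V2"
    and "0 < \<epsilon>"
    and "\<forall>x\<in>P1. \<forall>y\<in>P1. f (x + y) \<in> symmetric_nbhd UNIV (\<epsilon> *\<^sub>R v) (g x + h y)"
  shows "\<exists>!A. A \<in> P1 \<rightarrow>\<^sub>E UNIV \<and> additive_on P1 A \<and>
    (\<exists>\<beta> \<gamma> \<delta> :: real. 0 < \<beta> \<and> 0 < \<gamma> \<and> 0 < \<delta> \<and>
      (\<forall>x\<in>P1. \<forall>r::real. 1 < r \<longrightarrow>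
         A x \<in> symmetric_nbhd UNIV ((4 * r * \<epsilon> + \<beta>) *\<^sub>R v) (f x) \<and>
         A x \<in> symmetric_nbhd UNIV ((5 * r * \<epsilon> + \<gamma>) *\<^sub>R v) (g x) \<and>
         A x \<in> symmetric_nbhd UNIV ((5 * r * \<epsilon> + \<delta>) *\<^sub>R v) (h x)))"
proof -
  have P: "subcone P1" using assms(1) unfolding locally_convex_cone_def by simp
  note sep = assms(4) and compl = assms(5) and gen = assms(6) and \<epsilon> = assms(7)
  have v: "0 \<le> v" and bd: "\<exists>\<rho>::real. 0 < \<rho> \<and> 0 \<le> a + \<rho> *\<^sub>R v" for a
    using assms(2) gen
    unfolding full_locally_convex_cone_def abstract_nbhd_system_def generating_element_def
    by blast+
  have fgh: "near v \<epsilon> (f (x + y)) (g x + h y)" if "x \<in> P1" "y \<in> P1" for x y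
    using assms(8) that by (simp add: symmetric_nbhd_iff_near)
  have zero: "0 \<in> P1" using P unfolding subcone_def by simp
  define z where "z = g 0 + h 0"
  have fg: "near v \<epsilon> (f x) (g x + h 0)" and fh: "near v \<epsilon> (f x) (h x + g 0)"
    if "x \<in> P1" for x
    using fgh[OF that zero] fgh[OF zero that] by (simp_all add: add.commute)
  have "near v (3 * \<epsilon>) (f (x + y) - z) ((f x - z) + (f y - z))" if "x \<in> P1" "y \<in> P1" for x y
  proof -
    \<comment> \<open>The left side is \<open>g x + h y + z\<close>. Subtracting \<open>z\<close>
      twice, with one use of \<open>fgh\<close> in between, gives the defect
      \<open>3 * \<epsilon>\<close> for \<open>f - z\<close>.\<close>
    have "near v (\<epsilon> + \<epsilon>) (g x + h 0 + (h y + g 0)) (f x + f y)"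
      using near_add[OF near_sym[OF fg] near_sym[OF fh]] that by blast
    from near_translate[OF this, of "- z"]
    have "near v (\<epsilon> + \<epsilon>) (g x + h y) (f x + f y - z)"
      by (simp add: z_def algebra_simps)
    from near_translate[OF near_trans[OF fgh[OF that] this], of "- z"]
    show ?thesis by (simp add: algebra_simps)
  qed
  from hyers_stability[OF P v _ sep compl gen this] \<epsilon>
  obtain A where A: "additive_on P1 A"
    and "\<forall>x\<in>P1. \<forall>c>3 * \<epsilon>. near v c (A x) (f x - z)"
    by auto
  \<comment> \<open>Any radius above \<open>3 * \<epsilon>\<close> is available; this one fits below
    \<open>4 * r * \<epsilon>\<close> for every \<open>r > 1\<close>.\<close>
  then have Af: "near v (4 * \<epsilon>) (A x) (f x - z)" if "x \<in> P1" for x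
    using that \<epsilon> by simp
  \<comment> \<open>These constants undo the shift by \<open>z\<close>. For \<open>g\<close> and
    \<open>h\<close>, the terms \<open>h 0\<close> and \<open>g 0\<close> from \<open>fg\<close> and
    \<open>fh\<close> offset part of it. None of them depends on \<open>x\<close> or
    \<open>r\<close>.\<close>
  obtain \<beta> where \<beta>: "0 < \<beta>" "near v \<beta> (- z) 0" using near_bounded[OF v bd] by blast
  obtain \<gamma> where \<gamma>: "0 < \<gamma>" "near v \<gamma> (h 0 - z) 0" using near_bounded[OF v bd] by blast
  obtain \<delta> where \<delta>: "0 < \<delta>" "near v \<delta> (g 0 - z) 0" using near_bounded[OF v bd] by blast
  \<comment> \<open>Uniqueness as a HOL function requires fixing the values outside
    \<open>P1\<close>.\<close>
  define A' where "A' = restrict A P1"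
  have A'_eq: "A' x = A x" if "x \<in> P1" for x using that by (simp add: A'_def)
  have add': "additive_on P1 A'"
    using A P unfolding additive_on_def subcone_def by (simp add: A'_eq)
  have bounds: "near v (4 * r * \<epsilon> + \<beta>) (A' x) (f x)"
      "near v (5 * r * \<epsilon> + \<gamma>) (A' x) (g x)" "near v (5 * r * \<epsilon> + \<delta>) (A' x) (h x)"
    if x: "x \<in> P1" and r: "1 < r" for x r
  proof -
    have r\<epsilon>: "\<epsilon> \<le> r * \<epsilon>" using r \<epsilon> by simp
    have "near v (4 * \<epsilon> + \<beta>) (A x) (f x)"
      using near_trans[OF Af[OF x]] near_translate[OF \<beta>(2), of "f x"] by simp
    then show "near v (4 * r * \<epsilon> + \<beta>) (A' x) (f x)"
      using r\<epsilon> by (auto simp: A'_eq[OF x] elim: near_mono[OF v, rotated])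
    have "near v (4 * \<epsilon> + (\<epsilon> + \<gamma>)) (A x) (g x)"
      using near_trans[OF Af[OF x] near_trans[OF near_translate[OF fg[OF x], of "- z", simplified]]]
        near_translate[OF \<gamma>(2), of "g x"] by (simp add: algebra_simps)
    then show "near v (5 * r * \<epsilon> + \<gamma>) (A' x) (g x)"
      using r\<epsilon> by (auto simp: A'_eq[OF x] elim: near_mono[OF v, rotated])
    have "near v (4 * \<epsilon> + (\<epsilon> + \<delta>)) (A x) (h x)"
      using near_trans[OF Af[OF x] near_trans[OF near_translate[OF fh[OF x], of "- z", simplified]]]
        near_translate[OF \<delta>(2), of "h x"] by (simp add: algebra_simps)
    then show "near v (5 * r * \<epsilon> + \<delta>) (A' x) (h x)"
      using r\<epsilon> by (auto simp: A'_eq[OF x] elim: near_mono[OF v, rotated])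
  qed
  have uniq: "B = A'" if ext: "B \<in> P1 \<rightarrow>\<^sub>E UNIV" and add: "additive_on P1 B"
    and near: "\<And>x r. x \<in> P1 \<Longrightarrow> 1 < r \<Longrightarrow> near v (4 * r * \<epsilon> + c) (B x) (f x)" for B c
  proof (rule PiE_ext[OF ext])
    show "A' \<in> P1 \<rightarrow>\<^sub>E UNIV" by (simp add: A'_def)
    \<comment> \<open>Both maps are compared with \<open>f\<close> at the sample value
      \<open>r = 2\<close>; the competitor may come with its own constant \<open>c\<close>.\<close>
    have "near v (4 * 2 * \<epsilon> + c + (4 * 2 * \<epsilon> + \<beta>)) (B x) (A' x)" if "x \<in> P1" for x
      by (rule near_trans[OF near near_sym[OF bounds(1)]]) (use that in simp_all)
    from additive_on_unique[OF P v sep gen add add' this]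
    show "B x = A' x" if "x \<in> P1" for x
      using that by simp
  qed
  show ?thesis
    unfolding symmetric_nbhd_iff_near
  proof (intro ex1I[of _ A'] conjI)
    show "A' \<in> P1 \<rightarrow>\<^sub>E UNIV" by (simp add: A'_def)
    show "additive_on P1 A'" by (fact add')
  next
    show "\<exists>\<beta> \<gamma> \<delta> :: real. 0 < \<beta> \<and> 0 < \<gamma> \<and> 0 < \<delta> \<and>
        (\<forall>x\<in>P1. \<forall>r>1. near v (4 * r * \<epsilon> + \<beta>) (A' x) (f x) \<and>
          near v (5 * r * \<epsilon> + \<gamma>) (A' x) (g x) \<and> near v (5 * r * \<epsilon> + \<delta>) (A' x) (h x))"
      using \<beta>(1) \<gamma>(1) \<delta>(1) bounds by (intro exI[of _ \<beta>] exI[of _ \<gamma>] exI[of _ \<delta>]) simp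
  qed (elim conjE exE, rule uniq, assumption, assumption, blast)
qed

end
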